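(* There exists a matroid $M$ (possibly infinite) that has a circuit $C$ and a cocircuit $D$ such that $C\cap D$ is infinite.
   Context: Matroids are allowed to have infinite ground sets. A matroid $M$ consists of a set $E$ (its ground set) and a set $\mathcal{I}$ of subsets of $E$ (the independent sets) satisfying: (I1) $\emptyset\in\mathcal{I}$; (I2) $\mathcal{I}$ is closed under taking subsets; (I3) whenever $I,I'\in\mathcal{I}$ with $I'$ maximal in $\mathcal{I}$ (with respect to inclusion) and $I$ not maximal, there is $x\in I'\setminus I$ with $I+x\in\mathcal{I}$; (IM) whenever $I\subseteq X\subseteq E$ and $I\in\mathcal{I}$, the set $\{I'\in\mathcal{I}\mid I\subseteq I'\subseteq X\}$ has a maximal element. Bases are the maximal independent sets, and circuits are the minimal non-independent sets. The dual $M^*$ is the matroid on $E$ whose bases are the complements of the bases of $M$; cocircuits of $M$ are circuits of $M^*$. *)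

theory Defs
  imports Main
begin

definition maximal_in :: "'a set set \<Rightarrow> 'a set \<Rightarrow> bool"
  where "maximal_in \<F> A \<longleftrightarrow> A \<in> \<F> \<and> (\<forall>X\<in>\<F>. A \<subseteq> X \<longrightarrow> X = A)"

definition minimal_in :: "'a set set \<Rightarrow> 'a set \<Rightarrow> bool"
  where "minimal_in \<F> A \<longleftrightarrow> A \<in> \<F> \<and> (\<forall>X\<in>\<F>. X \<subseteq> A \<longrightarrow> X = A)"

text \<open>Matroids whose ground set \<open>E\<close> may be infinite.\<close>

locale matroid =
  fixes E :: "'a set" and \<I> :: "'a set set"
  assumes indep_subset_ground: "\<I> \<subseteq> Pow E"
    and I1: "{} \<in> \<I>"
    and I2: "\<And>I J. I \<in> \<I> \<Longrightarrow> J \<subseteq> I \<Longrightarrow> J \<in> \<I>"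
    and I3: "\<And>I I'. I \<in> \<I> \<Longrightarrow> \<not> maximal_in \<I> I \<Longrightarrow> maximal_in \<I> I' \<Longrightarrow>
               \<exists>x\<in>I' - I. insert x I \<in> \<I>"
    and IM: "\<And>I X. I \<in> \<I> \<Longrightarrow> I \<subseteq> X \<Longrightarrow> X \<subseteq> E \<Longrightarrow>
               \<exists>B. maximal_in {I' \<in> \<I>. I \<subseteq> I' \<and> I' \<subseteq> X} B"

definition matroid_base :: "'a set set \<Rightarrow> 'a set \<Rightarrow> bool"
  where "matroid_base \<I> B \<longleftrightarrow> maximal_in \<I> B"

definition matroid_circuit :: "'a set \<Rightarrow> 'a set set \<Rightarrow> 'a set \<Rightarrow> bool"
  where "matroid_circuit E \<I> C \<longleftrightarrow> minimal_in {X. X \<subseteq> E \<and> X \<notin> \<I>} C"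

text \<open>
  The independent sets of the dual. A matroid is determined by its bases, its independent
  sets being their subsets; the lemma below confirms that the bases of the dual are exactly
  the complements of the bases.
\<close>

definition dual_indep :: "'a set \<Rightarrow> 'a set set \<Rightarrow> 'a set set"
  where "dual_indep E \<I> = {J. \<exists>B. matroid_base \<I> B \<and> J \<subseteq> E - B}"

lemma (in matroid) matroid_base_dual_indep_iff:
  "matroid_base (dual_indep E \<I>) B' \<longleftrightarrow> (\<exists>B. matroid_base \<I> B \<and> B' = E - B)"
proof
  assume "matroid_base (dual_indep E \<I>) B'"
  then show "\<exists>B. matroid_base \<I> B \<and> B' = E - B"
    unfolding matroid_base_def maximal_in_def dual_indep_def by blast
next
  assume "\<exists>B. matroid_base \<I> B \<and> B' = E - B"
  then obtain B where B: "matroid_base \<I> B" "B' = E - B" by blast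
  have "X = E - B" if X: "X \<subseteq> E - B2" "matroid_base \<I> B2" "E - B \<subseteq> X" for X B2
  proof -
    have "B2 \<subseteq> E"
      using X(2) indep_subset_ground unfolding matroid_base_def maximal_in_def by blast
    with X have "B2 \<subseteq> B" by blast
    then have "B = B2"
      using X(2) B(1) unfolding matroid_base_def maximal_in_def by blast
    with X show ?thesis by blast
  qed
  then show "matroid_base (dual_indep E \<I>) B'"
    using B unfolding matroid_base_def[of "dual_indep E \<I>"] maximal_in_def[of "dual_indep E \<I>"]
    by (auto simp: dual_indep_def)
qed

definition matroid_cocircuit :: "'a set \<Rightarrow> 'a set set \<Rightarrow> 'a set \<Rightarrow> bool"
  where "matroid_cocircuit E \<I> D \<longleftrightarrow> matroid_circuit E (dual_indep E \<I>) D"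

end

theory Submission
  imports Defs
begin

text \<open>
  Truncating a matroid, that is, discarding its bases from the independent sets, again gives a
  matroid. Every base of the original matroid is a circuit of the truncation, while the cocircuits
  of the truncation are the complements of the flats of corank two. Now take the cycle matroid of
  the infinite graph with two vertices \<open>u\<close>, \<open>v\<close> of infinite degree, joined by infinitely many paths
  of length two; the \<open>i\<close>-th path has edges \<open>2i\<close> (at \<open>u\<close>) and \<open>2i+1\<close> (at \<open>v\<close>). The spanning tree
  consisting of all edges at \<open>u\<close> and the edge \<open>1\<close> is a circuit of the truncation. Its complement,
  all edges at \<open>v\<close> except the edge \<open>1\<close>, is a flat of corank two, with components that star, \<open>u\<close>,
  and the middle vertex of path \<open>0\<close>. So the tree is also a cocircuit.
\<close>

section \<open>Truncation of an arbitrary matroid\<close>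

definition truncation :: "'a set set \<Rightarrow> 'a set set"
  where "truncation \<I> = {I \<in> \<I>. \<not> maximal_in \<I> I}"

context matroid
begin

text \<open>Otherwise I3 augments \<open>insert y A\<close> from the base \<open>insert a A\<close>;
  only \<open>a\<close> is available, and the result properly contains that base.\<close>

lemma maximal_in_exchange:
  assumes B: "maximal_in \<I> (insert a A)" and A: "insert y A \<in> \<I>" "y \<notin> A"
  shows "maximal_in \<I> (insert y A)"
proof (rule ccontr)
  assume "\<not> maximal_in \<I> (insert y A)"
  from I3[OF A(1) this B] obtain x
    where "x \<in> insert a A - insert y A" "insert x (insert y A) \<in> \<I>" ..
  then have "a \<noteq> y" and "insert a (insert y A) \<in> \<I>" by auto
  moreover have "insert a A \<subseteq> insert a (insert y A)" by blast
  ultimately have "insert a (insert y A) = insert a A"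
    using B unfolding maximal_in_def by metis
  with \<open>a \<noteq> y\<close> A(2) show False by (metis insert_iff)
qed

text \<open>A larger member of the truncation would contain some \<open>insert y A\<close>, which is
  a base by exchange, so it would itself be that base. With the next lemma, the bases of the
  truncation are exactly the bases with one element removed.\<close>

lemma maximal_in_truncationI:
  assumes B: "maximal_in \<I> (insert a A)" and a: "a \<notin> A"
  shows "maximal_in (truncation \<I>) A"
  unfolding maximal_in_def[of "truncation \<I>"]
proof (intro conjI ballI impI)
  have indep: "insert a A \<in> \<I>" using B unfolding maximal_in_def by blast
  then have "A \<in> \<I>" by (rule I2) blast
  moreover have "\<not> maximal_in \<I> A" using indep a unfolding maximal_in_def by blast
  ultimately show "A \<in> truncation \<I>" unfolding truncation_def by blast
  fix X assume X: "X \<in> truncation \<I>" "A \<subseteq> X"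
  show "X = A"
  proof (rule ccontr)
    assume "X \<noteq> A"
    then obtain y where y: "y \<in> X" "y \<notin> A" using X(2) by blast
    have "X \<in> \<I>" "\<not> maximal_in \<I> X" using X(1) unfolding truncation_def by blast+
    then have "insert y A \<in> \<I>" using I2 y X(2) by blast
    then have "maximal_in \<I> (insert y A)" using maximal_in_exchange[OF B] y(2) by blast
    then have "X = insert y A" using \<open>X \<in> \<I>\<close> X(2) y unfolding maximal_in_def by blast
    with \<open>maximal_in \<I> (insert y A)\<close> \<open>\<not> maximal_in \<I> X\<close> show False by blast
  qed
qed

lemma maximal_in_truncationE:
  assumes "maximal_in (truncation \<I>) A"
  obtains a where "a \<notin> A" "maximal_in \<I> (insert a A)"
proof -
  have A: "A \<in> \<I>" "\<not> maximal_in \<I> A" using assms unfolding maximal_in_def truncation_def by blast+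
  then obtain X where X: "X \<in> \<I>" "A \<subseteq> X" "X \<noteq> A" unfolding maximal_in_def by blast
  then obtain a where a: "a \<in> X" "a \<notin> A" by blast
  then have "insert a A \<in> \<I>" using I2[OF X(1)] X(2) by blast
  moreover have "insert a A \<notin> truncation \<I>" using assms a(2) unfolding maximal_in_def by blast
  ultimately have "maximal_in \<I> (insert a A)" unfolding truncation_def by blast
  with a(2) that show thesis by blast
qed

lemma insert_in_truncation:
  assumes "insert a (insert b I) \<in> \<I>" "a \<notin> insert b I"
  shows "insert b I \<in> truncation \<I>"
proof -
  have "insert b I \<in> \<I>" using assms(1) by (rule I2) blast
  moreover have "\<not> maximal_in \<I> (insert b I)" using assms unfolding maximal_in_def by blast
  ultimately show ?thesis unfolding truncation_def by blast
qed

text \<open>Augment \<open>I\<close> twice towards the base \<open>insert e I'\<close>. At most one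
  of the new elements \<open>z\<close>, \<open>z'\<close> is \<open>e\<close>, and either may be
  added alone because the other keeps the result from being a base.\<close>

lemma truncation_I3:
  assumes I: "I \<in> truncation \<I>" "\<not> maximal_in (truncation \<I>) I"
    and I': "maximal_in (truncation \<I>) I'"
  shows "\<exists>x\<in>I' - I. insert x I \<in> truncation \<I>"
proof -
  obtain e where e: "maximal_in \<I> (insert e I')" using I' by (rule maximal_in_truncationE)
  have "I \<in> \<I>" "\<not> maximal_in \<I> I" using I(1) unfolding truncation_def by blast+
  then obtain z where z: "z \<in> insert e I' - I" "insert z I \<in> \<I>" using I3 e by blast
  \<comment> \<open>Were this a base, \<open>I\<close> would be a base of the truncation.\<close>
  have "\<not> maximal_in \<I> (insert z I)"
    using maximal_in_truncationI I(2) z(1) by blast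
  then obtain z' where z': "z' \<in> insert e I' - insert z I" "insert z' (insert z I) \<in> \<I>"
    using I3[OF z(2) _ e] by blast
  have "insert z I \<in> truncation \<I>" by (rule insert_in_truncation[OF z'(2)]) (use z' in blast)
  moreover have "insert z' I \<in> truncation \<I>"
    by (rule insert_in_truncation[of z]) (use z z' in \<open>auto simp: insert_commute\<close>)
  moreover have "z \<in> I' \<or> z' \<in> I'" using z(1) z'(1) by blast
  ultimately show ?thesis using z(1) z'(1) by blast
qed

text \<open>A maximal \<open>J\<close> of the original matroid still works unless it is a base; then
  removing one element outside \<open>I\<close> gives a base of the truncation.\<close>

lemma truncation_IM:
  assumes I: "I \<in> truncation \<I>" "I \<subseteq> X" "X \<subseteq> E"
  shows "\<exists>B. maximal_in {I' \<in> truncation \<I>. I \<subseteq> I' \<and> I' \<subseteq> X} B"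
proof -
  have "I \<in> \<I>" "\<not> maximal_in \<I> I" using I(1) unfolding truncation_def by blast+
  then obtain J where J: "maximal_in {I' \<in> \<I>. I \<subseteq> I' \<and> I' \<subseteq> X} J" using IM I(2,3) by blast
  show ?thesis
  proof (cases "maximal_in \<I> J")
    case False
    then have "maximal_in {I' \<in> truncation \<I>. I \<subseteq> I' \<and> I' \<subseteq> X} J"
      using J unfolding maximal_in_def[of "Collect _"] truncation_def by blast
    then show ?thesis by blast
  next
    case True
    have "I \<subseteq> J" "J \<subseteq> X" using J unfolding maximal_in_def by blast+
    moreover have "I \<noteq> J" using True \<open>\<not> maximal_in \<I> I\<close> by blast
    ultimately obtain x where x: "x \<in> J" "x \<notin> I" by blast
    then have "maximal_in (truncation \<I>) (J - {x})"
      using maximal_in_truncationI[of x "J - {x}"] True by (simp add: insert_absorb)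
    then have "maximal_in {I' \<in> truncation \<I>. I \<subseteq> I' \<and> I' \<subseteq> X} (J - {x})"
      using \<open>I \<subseteq> J\<close> \<open>J \<subseteq> X\<close> x unfolding maximal_in_def by blast
    then show ?thesis by blast
  qed
qed

text \<open>The assumption says that the empty set is not a base; a matroid of rank zero would leave
  no independent set at all.\<close>

lemma matroid_truncation:
  assumes "{} \<in> truncation \<I>"
  shows "matroid E (truncation \<I>)"
proof
  show "truncation \<I> \<subseteq> Pow E" using indep_subset_ground unfolding truncation_def by blast
  show "{} \<in> truncation \<I>" by (rule assms)
  show "J \<in> truncation \<I>" if "I \<in> truncation \<I>" "J \<subseteq> I" for I J
  proof -
    have I: "I \<in> \<I>" "\<not> maximal_in \<I> I" using that(1) unfolding truncation_def by blast+
    have "J \<in> \<I>" using I(1) that(2) by (rule I2)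
    moreover have "\<not> maximal_in \<I> J" using I that(2) unfolding maximal_in_def by blast
    ultimately show ?thesis unfolding truncation_def by blast
  qed
qed (fact truncation_I3, fact truncation_IM)

lemma matroid_circuit_truncation:
  assumes "maximal_in \<I> B"
  shows "matroid_circuit E (truncation \<I>) B"
proof -
  have B: "B \<in> \<I>" using assms unfolding maximal_in_def by blast
  have "X = B" if "X \<notin> truncation \<I>" "X \<subseteq> B" for X
  proof -
    have "maximal_in \<I> X" using that I2[OF B] unfolding truncation_def by blast
    with B that(2) show ?thesis unfolding maximal_in_def by blast
  qed
  moreover have "B \<subseteq> E" "B \<notin> truncation \<I>"
    using B assms indep_subset_ground unfolding truncation_def by blast+
  ultimately show ?thesis unfolding matroid_circuit_def minimal_in_def by blast
qed

end

section \<open>The cycle matroid of infinitely many parallel two-edge paths\<close>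

text \<open>Every cycle of the graph consists of two full paths, so a forest is an edge set with at
  most one full path.\<close>

definition two_edge_paths_indep :: "nat set set"
  where "two_edge_paths_indep = {I. \<exists>k. \<forall>i. 2 * i \<in> I \<longrightarrow> Suc (2 * i) \<in> I \<longrightarrow> i = k}"

declare double_not_eq_Suc_double [simp] Suc_double_not_eq_double [simp]

lemma even_odd_cases:
  fixes n :: nat
  obtains i where "n = 2 * i" | i where "n = Suc (2 * i)"
  by (metis evenE oddE Suc_eq_plus1)

lemma two_edge_paths_indepI:
  assumes "\<And>i. 2 * i \<in> I \<Longrightarrow> Suc (2 * i) \<in> I \<Longrightarrow> i = k"
  shows "I \<in> two_edge_paths_indep"
  using assms unfolding two_edge_paths_indep_def by blast

text \<open>Since \<open>B\<close> meets every path that \<open>X\<close> meets, \<open>J\<close>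
  can exceed \<open>B\<close> only by completing a path. Either \<open>X\<close> has no full path,
  or the single one allowed in \<open>J\<close> is already in \<open>B\<close>.
  \<open>X = UNIV\<close> yields bases, general \<open>X\<close> yields IM.\<close>

lemma two_edge_paths_maximalI:
  assumes k: "2 * k \<in> B \<and> Suc (2 * k) \<in> B \<or> (\<forall>i. 2 * i \<notin> X \<or> Suc (2 * i) \<notin> X)"
    and meets: "\<And>i. 2 * i \<in> X \<or> Suc (2 * i) \<in> X \<Longrightarrow> 2 * i \<in> B \<or> Suc (2 * i) \<in> B"
    and J: "J \<in> two_edge_paths_indep" "B \<subseteq> J" "J \<subseteq> X"
  shows "J = B"
proof -
  obtain l where l: "\<And>i. 2 * i \<in> J \<Longrightarrow> Suc (2 * i) \<in> J \<Longrightarrow> i = l"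
    using J(1) unfolding two_edge_paths_indep_def by blast
  have "n \<in> B" if "n \<in> J" for n
    by (rule even_odd_cases[of n]) (metis J(2,3) k l meets subsetD that)+
  with J(2) show ?thesis by blast
qed

lemma two_edge_paths_maximal_iff:
  "maximal_in two_edge_paths_indep B \<longleftrightarrow>
     B \<in> two_edge_paths_indep \<and> (\<forall>i. 2 * i \<in> B \<or> Suc (2 * i) \<in> B) \<and>
     (\<exists>k. 2 * k \<in> B \<and> Suc (2 * k) \<in> B)" (is "?L \<longleftrightarrow> ?R")
proof
  assume L: ?L
  then have B: "B \<in> two_edge_paths_indep" unfolding maximal_in_def by blast
  have max: "x \<in> B" if "insert x B \<in> two_edge_paths_indep" for x
    using L that unfolding maximal_in_def by blast
  obtain k where k: "\<And>i. 2 * i \<in> B \<Longrightarrow> Suc (2 * i) \<in> B \<Longrightarrow> i = k"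
    using B unfolding two_edge_paths_indep_def by blast
  have meets: "2 * i \<in> B \<or> Suc (2 * i) \<in> B" for i
  proof (rule ccontr)
    assume *: "\<not> ?thesis"
    have "insert (2 * i) B \<in> two_edge_paths_indep"
      by (rule two_edge_paths_indepI[of _ k]) (use * in \<open>auto dest: k\<close>)
    with max * show False by blast
  qed
  have "\<exists>k. 2 * k \<in> B \<and> Suc (2 * k) \<in> B"
  proof (rule ccontr)
    assume *: "\<not> ?thesis"
    \<comment> \<open>As \<open>B\<close> has no full path, either insertion completes at most path
      0.\<close>
    have "insert 0 B \<in> two_edge_paths_indep" "insert 1 B \<in> two_edge_paths_indep"
      by (rule two_edge_paths_indepI[of _ 0]; use * in auto)+
    then have "0 \<in> B" "1 \<in> B" using max by blast+
    with *[unfolded not_ex, THEN spec[of _ 0]] show False by simp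
  qed
  with B meets show ?R by blast
next
  assume ?R
  then show ?L
    unfolding maximal_in_def using two_edge_paths_maximalI[of _ B UNIV] by blast
qed

text \<open>If \<open>I\<close> meets every path, it has no full one, and an edge of the full path
  of \<open>B\<close> can be added. Otherwise \<open>B\<close> has an edge on a path missed by
  \<open>I\<close>, and adding it completes nothing.\<close>

lemma two_edge_paths_I3:
  assumes I: "I \<in> two_edge_paths_indep" "\<not> maximal_in two_edge_paths_indep I"
    and B: "maximal_in two_edge_paths_indep B"
  shows "\<exists>x\<in>B - I. insert x I \<in> two_edge_paths_indep"
proof (cases "\<forall>i. 2 * i \<in> I \<or> Suc (2 * i) \<in> I")
  case True
  then have no: "\<not> (2 * i \<in> I \<and> Suc (2 * i) \<in> I)" for i
    using I two_edge_paths_maximal_iff by blast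
  obtain k where k: "2 * k \<in> B" "Suc (2 * k) \<in> B" using B two_edge_paths_maximal_iff by blast
  have "insert (2 * k) I \<in> two_edge_paths_indep" "insert (Suc (2 * k)) I \<in> two_edge_paths_indep"
    by (rule two_edge_paths_indepI[of _ k]; use no in auto)+
  with k no show ?thesis by blast
next
  case False
  then obtain i where i: "2 * i \<notin> I" "Suc (2 * i) \<notin> I" by blast
  obtain k where k: "\<And>i. 2 * i \<in> I \<Longrightarrow> Suc (2 * i) \<in> I \<Longrightarrow> i = k"
    using I(1) unfolding two_edge_paths_indep_def by blast
  have "insert (2 * i) I \<in> two_edge_paths_indep" "insert (Suc (2 * i)) I \<in> two_edge_paths_indep"
    by (rule two_edge_paths_indepI[of _ k]; use i in \<open>auto dest: k\<close>)+
  moreover have "2 * i \<in> B \<or> Suc (2 * i) \<in> B" using B two_edge_paths_maximal_iff by blast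
  ultimately show ?thesis using i by blast
qed

lemma two_edge_paths_IM:
  assumes I: "I \<in> two_edge_paths_indep" "I \<subseteq> X"
  shows "\<exists>B. maximal_in {I' \<in> two_edge_paths_indep. I \<subseteq> I' \<and> I' \<subseteq> X} B"
proof -
  \<comment> \<open>\<open>T\<close> adds to \<open>I\<close> one edge of each path that meets
    \<open>X\<close> but not \<open>I\<close>, the even one if possible, so that no new path is
    completed.\<close>
  define T where "T = I \<union> {2 * i |i. 2 * i \<in> X \<and> Suc (2 * i) \<notin> I}
    \<union> {Suc (2 * i) |i. Suc (2 * i) \<in> X \<and> 2 * i \<notin> X}"
  have even: "2 * i \<in> T \<longleftrightarrow> 2 * i \<in> I \<or> 2 * i \<in> X \<and> Suc (2 * i) \<notin> I" for i
    unfolding T_def by auto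
  have odd: "Suc (2 * i) \<in> T \<longleftrightarrow> Suc (2 * i) \<in> I \<or> Suc (2 * i) \<in> X \<and> 2 * i \<notin> X" for i
    unfolding T_def by auto
  have T: "I \<subseteq> T" "T \<subseteq> X" using I(2) unfolding T_def by blast+
  have both: "2 * i \<in> I \<and> Suc (2 * i) \<in> I" if "2 * i \<in> T" "Suc (2 * i) \<in> T" for i
    using that I(2) unfolding even odd by blast
  have meets: "2 * i \<in> T \<or> Suc (2 * i) \<in> T" if "2 * i \<in> X \<or> Suc (2 * i) \<in> X" for i
    using that I(2) unfolding even odd by blast
  \<comment> \<open>If \<open>T\<close> has no full path but \<open>X\<close> has one, completing
    one such path makes the set maximal.\<close>
  obtain B k where B: "T \<subseteq> B" "B \<subseteq> X" "B \<in> two_edge_paths_indep"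
    "2 * k \<in> B \<and> Suc (2 * k) \<in> B \<or> (\<forall>i. 2 * i \<notin> X \<or> Suc (2 * i) \<notin> X)"
  proof (cases "(\<exists>k. 2 * k \<in> T \<and> Suc (2 * k) \<in> T) \<or> (\<forall>i. 2 * i \<notin> X \<or> Suc (2 * i) \<notin> X)")
    case True
    have "T \<in> two_edge_paths_indep"
      using I(1) both unfolding two_edge_paths_indep_def by blast
    with True T(2) that[of T] show ?thesis by blast
  next
    case False
    then obtain k where k: "2 * k \<in> X" "Suc (2 * k) \<in> X" by blast
    have "insert (2 * k) (insert (Suc (2 * k)) T) \<in> two_edge_paths_indep"
      by (rule two_edge_paths_indepI[of _ k]) (use False in auto)
    with k T(2) that[of "insert (2 * k) (insert (Suc (2 * k)) T)" k] show ?thesis by blast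
  qed
  have "J = B" if "J \<in> two_edge_paths_indep" "B \<subseteq> J" "J \<subseteq> X" for J
    using two_edge_paths_maximalI[OF B(4) _ that] meets B(1) by blast
  then have "maximal_in {I' \<in> two_edge_paths_indep. I \<subseteq> I' \<and> I' \<subseteq> X} B"
    using B(1,2,3) T(1) unfolding maximal_in_def by blast
  then show ?thesis by blast
qed

interpretation two_edge_paths: matroid UNIV two_edge_paths_indep
proof
  show "{} \<in> two_edge_paths_indep" unfolding two_edge_paths_indep_def by blast
  show "J \<in> two_edge_paths_indep" if "I \<in> two_edge_paths_indep" "J \<subseteq> I" for I J
    using that unfolding two_edge_paths_indep_def by blast
qed (simp_all add: two_edge_paths_I3 two_edge_paths_IM)

section \<open>The set that is both a circuit and a cocircuit\<close>

lemma star_plus_edge_maximal: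
  "maximal_in two_edge_paths_indep (insert 1 {n. even n})"
  "maximal_in two_edge_paths_indep (insert (2 * i) {n. odd n})"
  unfolding two_edge_paths_maximal_iff
  by (auto intro: two_edge_paths_indepI[of _ 0] two_edge_paths_indepI[of _ i])

text \<open>Dependent in the dual means meeting every base of the truncation. For minimality, each
  \<open>e\<close> in the set has a base of the truncation meeting the set only in
  \<open>e\<close>.\<close>

lemma two_edge_paths_cocircuit:
  "matroid_cocircuit UNIV (truncation two_edge_paths_indep) (insert 1 {n. even n})"
proof -
  let ?T = "truncation two_edge_paths_indep" and ?D = "insert 1 {n::nat. even n}"
  have "?D \<notin> dual_indep UNIV ?T"
  proof
    assume "?D \<in> dual_indep UNIV ?T"
    then obtain B where B: "maximal_in ?T B" "?D \<inter> B = {}"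
      unfolding dual_indep_def matroid_base_def by blast
    have disj: "2 * i \<notin> B" "1 \<notin> B" for i using B(2) by (simp_all add: disjoint_iff)
    \<comment> \<open>All edges of \<open>B\<close> are at \<open>v\<close>, so only path 0 becomes
      full; the spare edge 0 shows that \<open>insert 1 B\<close> survives truncation.\<close>
    have "insert 0 (insert 1 B) \<in> two_edge_paths_indep"
      by (rule two_edge_paths_indepI[of _ 0]) (simp add: disj)
    moreover have "0 \<notin> B" using disj(1)[of 0] by simp
    ultimately have "insert 1 B \<in> ?T" by (intro two_edge_paths.insert_in_truncation) auto
    with B(1) disj(2) show False unfolding maximal_in_def by blast
  qed
  moreover have "X = ?D" if X: "X \<notin> dual_indep UNIV ?T" "X \<subseteq> ?D" for X
  proof (rule ccontr)
    assume "X \<noteq> ?D"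
    then obtain e where e: "e \<in> ?D" "e \<notin> X" using X(2) by blast
    have base: "\<not> maximal_in ?T B" if "B \<inter> X = {}" for B
      using X(1) that unfolding dual_indep_def matroid_base_def by blast
    show False
    proof (cases "e = 1")
      case True
      have "maximal_in ?T {n. odd n}"
        by (rule two_edge_paths.maximal_in_truncationI[OF star_plus_edge_maximal(2)[of 0]]) simp
      moreover have "{n. odd n} \<inter> X = {}" using True e(2) X(2) by auto
      ultimately show False using base by blast
    next
      case False
      then obtain i where i: "e = 2 * i" using e(1) by (auto elim: evenE)
      \<comment> \<open>Removing the edge 1 from the tree formed by the star at \<open>v\<close> and
        \<open>e\<close> leaves \<open>e\<close> as the only common element with
        \<open>?D\<close>.\<close>
      let ?B = "insert e {n. odd n} - {1}"
      have "insert 1 ?B = insert (2 * i) {n. odd n}" using i by auto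
      then have "maximal_in ?T ?B"
        using star_plus_edge_maximal(2)[of i] two_edge_paths.maximal_in_truncationI[of 1 ?B]
        by simp
      moreover have "?B \<inter> X = {}" using e(2) X(2) by blast
      ultimately show False using base by blast
    qed
  qed
  ultimately show ?thesis
    unfolding matroid_cocircuit_def matroid_circuit_def minimal_in_def by blast
qed

theorem theorem1p2:
  "\<exists>(E :: nat set) \<I> C D.
     matroid E \<I> \<and> matroid_circuit E \<I> C \<and> matroid_cocircuit E \<I> D \<and> infinite (C \<inter> D)"
proof -
  let ?C = "insert 1 {n::nat. even n}"
  have "{} \<in> truncation two_edge_paths_indep"
    using two_edge_paths.I1 two_edge_paths_maximal_iff unfolding truncation_def by blast
  then have "matroid UNIV (truncation two_edge_paths_indep)"
    by (rule two_edge_paths.matroid_truncation)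
  moreover have "matroid_circuit UNIV (truncation two_edge_paths_indep) ?C"
    using star_plus_edge_maximal(1) by (rule two_edge_paths.matroid_circuit_truncation)
  moreover have "infinite (?C \<inter> ?C)"
  proof -
    have "infinite (range (\<lambda>i::nat. 2 * i))" by (simp add: finite_image_iff inj_def)
    moreover have "range (\<lambda>i::nat. 2 * i) \<subseteq> ?C" by auto
    ultimately show ?thesis using finite_subset by auto
  qed
  ultimately show ?thesis using two_edge_paths_cocircuit by blast
qed

end
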